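(* Let $h_d,h_{b,u},h_{b,d_1},h_{b,d_2},h_{d_1,u},h_{d_2,u},\eta_1,\eta_2>0$, $P_{1,M},P_{2,M}>0$ and $0<P_{u,m}\le P_{u,M}$. (First decoding order) There exists $(P_1,P_2,P_u)\in[0,P_{1,M}]\times[0,P_{2,M}]\times[P_{u,m},P_{u,M}]$ with $$P_uh_{b,u}<P_2h_{b,d_2}-P_1h_{b,d_1},\quad P_uh_{d_1,u}>P_2h_d+P_1\eta_1,\quad P_uh_{b,u}<P_1h_{b,d_1},\quad P_uh_{d_2,u}>P_1h_d+P_2\eta_2$$ if and only if all of the following hold: $$h_{b,d_1}h_{d_1,u}-\eta_1h_{b,u}>2h_{b,u}h_d\frac{h_{b,d_1}}{h_{b,d_2}},\qquad h_{b,d_1}h_{d_2,u}-h_{b,u}h_d>2h_{b,u}\eta_2\frac{h_{b,d_1}}{h_{b,d_2}},$$ $$P_{u,m}\frac{h_{b,u}}{h_{b,d_1}}<P_{1,M},\qquad 2P_{u,m}\frac{h_{b,u}}{h_{b,d_2}}<P_{2,M}.$$ (Second decoding order) There exists $(P_1,P_2,P_u)\in[0,P_{1,M}]\times[0,P_{2,M}]\times[P_{u,m},P_{u,M}]$ with $$P_uh_{b,u}<P_1h_{b,d_1}-P_2h_{b,d_2},\quad P_uh_{d_1,u}>P_2h_d+P_1\eta_1,\quad P_uh_{b,u}<P_2h_{b,d_2},\quad P_uh_{d_2,u}>P_1h_d+P_2\eta_2$$ if and only if all of the following hold: $$h_{d_1,u}h_{b,d_2}-h_dh_{b,u}>2\frac{\eta_1h_{b,u}h_{b,d_2}}{h_{b,d_1}},\qquad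 h_{d_2,u}h_{b,d_2}-\eta_2h_{b,u}>2\frac{h_{b,u}h_dh_{b,d_2}}{h_{b,d_1}},$$ $$2P_{u,m}\frac{h_{b,u}}{h_{b,d_1}}<P_{1,M},\qquad P_{u,m}\frac{h_{b,u}}{h_{b,d_2}}<P_{2,M}.$$
   Context: These are the feasibility conditions of full-duplex D2D power allocation with mutual successive interference cancellation. $P_1,P_2$ are the transmit powers of D2D devices $d_1,d_2$, and $P_u$ that of the cellular user $u$; $P_{1,M},P_{2,M},P_{u,M}$ are their maxima. $P_{u,m}$ is the minimum power of $u$ needed to meet its target rate. The $h$'s are channel gains ($h_d$: between $d_1$ and $d_2$; $h_{b,\cdot}$: to the base station; $h_{d_j,u}$: from $u$ to $d_j$) and $\eta_1,\eta_2$ are self-interference factors. The four strict inequalities in each case are the power multiplexing conditions of the given decoding order at the base station. *)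

theory Defs
  imports Complex_Main
begin

end

(* With g the gain of the cellular user, p and q those of the weaker and the stronger device at the
   base station, the conditions there force P > U * (g/p) and Q > 2 * U * (g/q); the interference
   terms increase in P and Q, so this gives necessity. Conversely take U minimal and (P, Q) a
   multiple t > 1 of this corner: all conditions at the base station then hold, and the remaining
   strict inequalities, valid at t = 1, persist for t close to 1. *)

theory Submission
  imports Defs
begin

lemma eventually_mult_less_at_right_one:
  fixes x y :: real
  assumes "x < y"
  shows "\<forall>\<^sub>F t in at_right 1. t * x < y"
proof -
  have "((\<lambda>t. t * x) \<longlongrightarrow> 1 * x) (at_right 1)"
    by (intro tendsto_intros)
  with assms show ?thesis
    by (intro order_tendstoD) auto
qed

lemma bex_swap: "(\<exists>x\<in>A. \<exists>y\<in>B. P x y) \<longleftrightarrow> (\<exists>y\<in>B. \<exists>x\<in>A. P x y)"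
  by blast

text \<open>Both decoding orders are instances, differing in which device has the power
  \<open>Q\<close> and must exceed the cellular user and the other device together at the base
  station. Leaving \<alpha>, \<beta>, \<gamma>, \<delta> arbitrary lets the self-interference
  factors and the device-to-device gain change places. \<open>U\<close> disappears from the two
  interference criteria because these conditions are homogeneous in the powers.\<close>

lemma feasible_iff:
  fixes g p q c e \<alpha> \<beta> \<gamma> \<delta> PM QM Um UM :: real
  assumes pos: "g > 0" "p > 0" "q > 0"
    and nonneg: "\<alpha> \<ge> 0" "\<beta> \<ge> 0" "\<gamma> \<ge> 0" "\<delta> \<ge> 0"
    and Um: "0 < Um" "Um \<le> UM"
  shows "(\<exists>P \<in> {0..PM}. \<exists>Q \<in> {0..QM}. \<exists>U \<in> {Um..UM}.
            U * g < Q * q - P * p \<and> U * g < P * p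
          \<and> U * c > Q * \<alpha> + P * \<beta> \<and> U * e > P * \<gamma> + Q * \<delta>)
     \<longleftrightarrow> 2 * (g / q) * \<alpha> + (g / p) * \<beta> < c
       \<and> (g / p) * \<gamma> + 2 * (g / q) * \<delta> < e
       \<and> Um * (g / p) < PM \<and> 2 * Um * (g / q) < QM"
    (is "?L \<longleftrightarrow> ?R")
proof
  assume ?L
  then obtain P Q U where
    b: "P \<le> PM" "Q \<le> QM" "Um \<le> U" and
    h: "U * g < Q * q - P * p" "U * g < P * p"
       "U * c > Q * \<alpha> + P * \<beta>" "U * e > P * \<gamma> + Q * \<delta>"
    by auto
  have U: "U > 0" using b Um by linarith
  have P: "U * (g / p) < P" using h(2) pos by (simp add: field_simps)
  \<comment> \<open>Adding the two base-station conditions cancels \<open>P * p\<close>; this is the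
    source of the factor 2.\<close>
  have "2 * U * g < Q * q" using h by linarith
  then have Q: "2 * U * (g / q) < Q" using pos by (simp add: field_simps)
  have "U * (2 * (g / q) * \<alpha> + (g / p) * \<beta>) \<le> Q * \<alpha> + P * \<beta>"
    using mult_right_mono[OF less_imp_le[OF Q] nonneg(1)]
      mult_right_mono[OF less_imp_le[OF P] nonneg(2)] by (simp add: algebra_simps)
  then have "U * (2 * (g / q) * \<alpha> + (g / p) * \<beta>) < U * c" using h by linarith
  moreover have "U * ((g / p) * \<gamma> + 2 * (g / q) * \<delta>) \<le> P * \<gamma> + Q * \<delta>"
    using mult_right_mono[OF less_imp_le[OF P] nonneg(3)]
      mult_right_mono[OF less_imp_le[OF Q] nonneg(4)] by (simp add: algebra_simps)
  then have "U * ((g / p) * \<gamma> + 2 * (g / q) * \<delta>) < U * e" using h by linarith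
  \<comment> \<open>The power caps have to be stated at the least admissible \<open>U\<close>,
    whereas the corner bounds above are at the actual \<open>U\<close>.\<close>
  moreover have "Um * (g / p) \<le> U * (g / p)" "2 * Um * (g / q) \<le> 2 * U * (g / q)"
    using b pos by (intro mult_right_mono; simp)+
  ultimately show ?R using U P Q b mult_less_cancel_left_pos[OF U] by auto
next
  assume R: ?R
  \<comment> \<open>The filter is one-sided because at t = 1 both base-station conditions are
    equalities. Being nontrivial, it yields one t that serves all five requirements.\<close>
  have "\<forall>\<^sub>F t in at_right (1::real). t > 1"
    by (simp add: eventually_at_right_less)
  moreover have "\<forall>\<^sub>F t in at_right 1. t * (2 * (g / q) * \<alpha> + (g / p) * \<beta>) < c"
    "\<forall>\<^sub>F t in at_right 1. t * ((g / p) * \<gamma> + 2 * (g / q) * \<delta>) < e"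
    "\<forall>\<^sub>F t in at_right 1. t * (Um * (g / p)) < PM"
    "\<forall>\<^sub>F t in at_right 1. t * (2 * Um * (g / q)) < QM"
    using R by (blast intro: eventually_mult_less_at_right_one)+
  ultimately have "\<forall>\<^sub>F t in at_right 1. t > 1
      \<and> t * (2 * (g / q) * \<alpha> + (g / p) * \<beta>) < c
      \<and> t * ((g / p) * \<gamma> + 2 * (g / q) * \<delta>) < e
      \<and> t * (Um * (g / p)) < PM \<and> t * (2 * Um * (g / q)) < QM"
    by eventually_elim blast
  then obtain t where t: "t > 1"
      "t * (2 * (g / q) * \<alpha> + (g / p) * \<beta>) < c"
      "t * ((g / p) * \<gamma> + 2 * (g / q) * \<delta>) < e"
      "t * (Um * (g / p)) < PM" "t * (2 * Um * (g / q)) < QM"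
    using eventually_happens'[OF trivial_limit_at_right_real] by blast
  define P Q where "P = t * (Um * (g / p))" and "Q = t * (2 * Um * (g / q))"
  \<comment> \<open>Since \<open>Q * q\<close> is twice \<open>P * p\<close>, both base-station
    conditions reduce to the single inequality \<open>lt\<close>.\<close>
  have Pp: "P * p = t * (Um * g)" and Qq: "Q * q = 2 * (t * (Um * g))"
    using pos by (simp_all add: P_def Q_def)
  have lt: "Um * g < t * (Um * g)" using t(1) pos Um by simp
  have "Q * \<alpha> + P * \<beta> = Um * (t * (2 * (g / q) * \<alpha> + (g / p) * \<beta>))"
    "P * \<gamma> + Q * \<delta> = Um * (t * ((g / p) * \<gamma> + 2 * (g / q) * \<delta>))"
    by (simp_all add: P_def Q_def algebra_simps)
  then have "Q * \<alpha> + P * \<beta> < Um * c" "P * \<gamma> + Q * \<delta> < Um * e"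
    using mult_strict_left_mono[OF t(2) Um(1)] mult_strict_left_mono[OF t(3) Um(1)] by simp_all
  moreover have "P \<in> {0..PM}" "Q \<in> {0..QM}" "Um \<in> {Um..UM}"
    using t pos Um by (auto simp: P_def Q_def)
  moreover have "Um * g < Q * q - P * p" "Um * g < P * p"
    using Pp Qq lt by linarith+
  ultimately show ?L by blast
qed

theorem mainTheorem2:
  fixes h_d h_bu h_bd1 h_bd2 h_d1u h_d2u \<eta>1 \<eta>2 P1M P2M Pum PuM :: real
  assumes "h_d > 0" "h_bu > 0" "h_bd1 > 0" "h_bd2 > 0" "h_d1u > 0" "h_d2u > 0"
    and "\<eta>1 > 0" "\<eta>2 > 0"
    and "P1M > 0" "P2M > 0"
    and "0 < Pum" "Pum \<le> PuM"
  shows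
    "((\<exists>P1 \<in> {0..P1M}. \<exists>P2 \<in> {0..P2M}. \<exists>Pu \<in> {Pum..PuM}.
          Pu * h_bu < P2 * h_bd2 - P1 * h_bd1
        \<and> Pu * h_d1u > P2 * h_d + P1 * \<eta>1
        \<and> Pu * h_bu < P1 * h_bd1
        \<and> Pu * h_d2u > P1 * h_d + P2 * \<eta>2)
      \<longleftrightarrow>
          h_bd1 * h_d1u - \<eta>1 * h_bu > 2 * h_bu * h_d * (h_bd1 / h_bd2)
        \<and> h_bd1 * h_d2u - h_bu * h_d > 2 * h_bu * \<eta>2 * (h_bd1 / h_bd2)
        \<and> Pum * (h_bu / h_bd1) < P1M
        \<and> 2 * Pum * (h_bu / h_bd2) < P2M)
     \<and>
     ((\<exists>P1 \<in> {0..P1M}. \<exists>P2 \<in> {0..P2M}. \<exists>Pu \<in> {Pum..PuM}.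
          Pu * h_bu < P1 * h_bd1 - P2 * h_bd2
        \<and> Pu * h_d1u > P2 * h_d + P1 * \<eta>1
        \<and> Pu * h_bu < P2 * h_bd2
        \<and> Pu * h_d2u > P1 * h_d + P2 * \<eta>2)
      \<longleftrightarrow>
          h_d1u * h_bd2 - h_d * h_bu > 2 * ((\<eta>1 * h_bu * h_bd2) / h_bd1)
        \<and> h_d2u * h_bd2 - \<eta>2 * h_bu > 2 * ((h_bu * h_d * h_bd2) / h_bd1)
        \<and> 2 * Pum * (h_bu / h_bd1) < P1M
        \<and> Pum * (h_bu / h_bd2) < P2M)"
proof -
  \<comment> \<open>Division by \<open>h_bd1\<close> gives the normalised form; in the second order
    the divisor is \<open>h_bd2\<close>.\<close>
  have "h_bd1 * h_d1u - \<eta>1 * h_bu > 2 * h_bu * h_d * (h_bd1 / h_bd2)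
      \<longleftrightarrow> 2 * (h_bu / h_bd2) * h_d + (h_bu / h_bd1) * \<eta>1 < h_d1u"
    "h_bd1 * h_d2u - h_bu * h_d > 2 * h_bu * \<eta>2 * (h_bd1 / h_bd2)
      \<longleftrightarrow> (h_bu / h_bd1) * h_d + 2 * (h_bu / h_bd2) * \<eta>2 < h_d2u"
    using assms by (simp_all add: field_simps)
  note first = this
  have "h_d1u * h_bd2 - h_d * h_bu > 2 * ((\<eta>1 * h_bu * h_bd2) / h_bd1)
      \<longleftrightarrow> 2 * (h_bu / h_bd1) * \<eta>1 + (h_bu / h_bd2) * h_d < h_d1u"
    "h_d2u * h_bd2 - \<eta>2 * h_bu > 2 * ((h_bu * h_d * h_bd2) / h_bd1)
      \<longleftrightarrow> (h_bu / h_bd2) * \<eta>2 + 2 * (h_bu / h_bd1) * h_d < h_d2u"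
    using assms by (simp_all add: field_simps)
  note second = this
  have part1: "(\<exists>P1 \<in> {0..P1M}. \<exists>P2 \<in> {0..P2M}. \<exists>Pu \<in> {Pum..PuM}.
          Pu * h_bu < P2 * h_bd2 - P1 * h_bd1
        \<and> Pu * h_d1u > P2 * h_d + P1 * \<eta>1
        \<and> Pu * h_bu < P1 * h_bd1
        \<and> Pu * h_d2u > P1 * h_d + P2 * \<eta>2)
    \<longleftrightarrow> (\<exists>P \<in> {0..P1M}. \<exists>Q \<in> {0..P2M}. \<exists>U \<in> {Pum..PuM}.
          U * h_bu < Q * h_bd2 - P * h_bd1 \<and> U * h_bu < P * h_bd1
        \<and> U * h_d1u > Q * h_d + P * \<eta>1 \<and> U * h_d2u > P * h_d + Q * \<eta>2)"
    by blast
  \<comment> \<open>The devices exchange roles: \<open>P\<close> now stands for \<open>P2\<close>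
    and \<open>Q\<close> for \<open>P1\<close>, so the quantifiers must be swapped too.\<close>
  have part2: "(\<exists>P1 \<in> {0..P1M}. \<exists>P2 \<in> {0..P2M}. \<exists>Pu \<in> {Pum..PuM}.
          Pu * h_bu < P1 * h_bd1 - P2 * h_bd2
        \<and> Pu * h_d1u > P2 * h_d + P1 * \<eta>1
        \<and> Pu * h_bu < P2 * h_bd2
        \<and> Pu * h_d2u > P1 * h_d + P2 * \<eta>2)
    \<longleftrightarrow> (\<exists>P \<in> {0..P2M}. \<exists>Q \<in> {0..P1M}. \<exists>U \<in> {Pum..PuM}.
          U * h_bu < Q * h_bd1 - P * h_bd2 \<and> U * h_bu < P * h_bd2
        \<and> U * h_d1u > Q * \<eta>1 + P * h_d \<and> U * h_d2u > P * \<eta>2 + Q * h_d)"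
    by (subst bex_swap) (simp only: conj_ac add.commute)
  have nonneg: "h_d \<ge> 0" "\<eta>1 \<ge> 0" "\<eta>2 \<ge> 0"
    using assms by simp_all
  show ?thesis
    \<comment> \<open>The interference coefficients (\<alpha>, \<beta>, \<gamma>, \<delta>) are
      (\<open>h_d\<close>, \<eta>1, \<open>h_d\<close>, \<eta>2) in the first order and (\<eta>1,
      \<open>h_d\<close>, \<eta>2, \<open>h_d\<close>) in the second. There the two power caps come
      out in reverse order.\<close>
    unfolding first second part1 part2
      feasible_iff[OF assms(2,3,4) nonneg(1,2,1,3) assms(11,12)]
      feasible_iff[OF assms(2,4,3) nonneg(2,1,3,1) assms(11,12)]
    by blast
qed

end
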